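(* Let $(a_n^k)_{n\ge 0,\,k\ge 0}$ be an array of real numbers satisfying $$a_n^k=a_{n-1}^k+a_n^{k-1}\qquad (n\ge 1,\ k\ge 1).$$ Define the formal power series ${}^0a(t)=\sum_{n=1}^{\infty}a_n^0t^n$ and ${}^0\overline{a(t)}=\sum_{k=1}^{\infty}a_0^kt^k$. Then for every integer $k\ge 1$, $${}^k a(t):=\sum_{n=1}^{\infty}a_n^k t^n=\frac{1}{(1-t)^k}\left\{{}^0a(t)+\frac{t}{1-t}\sum_{r=1}^{k}a_0^r(1-t)^r\right\},$$ and for every integer $n\ge 1$, $${}^n\overline{a(t)}:=\sum_{k=1}^{\infty}a_n^k t^k=\frac{1}{(1-t)^n}\left\{{}^0\overline{a(t)}+\frac{t}{1-t}\sum_{j=1}^{n}a_j^0(1-t)^j\right\},$$ as identities of formal power series in $t$.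
   Context: The array is determined by the two initial sequences $a_n^0$ (first row, $n\ge 0$) and $a_0^k$ (first column, $k\ge 0$); $k$ indexes rows and $n$ indexes columns. *)

theory Defs
  imports "HOL-Computational_Algebra.Formal_Power_Series"
begin

text \<open>
  An array is a function \<open>a :: nat \<Rightarrow> nat \<Rightarrow> real\<close>, where \<open>a k n\<close> stands for $a_n^k$:
  the row index (superscript) comes first, the column index (subscript) second.
\<close>

text \<open>Both series start at exponent 1, so the constant coefficient is 0 whatever the array is.\<close>

definition row_series :: "(nat \<Rightarrow> nat \<Rightarrow> real) \<Rightarrow> nat \<Rightarrow> real fps" where
  "row_series a k = Abs_fps (\<lambda>n. if n \<ge> 1 then a k n else 0)"

definition column_series :: "(nat \<Rightarrow> nat \<Rightarrow> real) \<Rightarrow> nat \<Rightarrow> real fps" where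
  "column_series a n = Abs_fps (\<lambda>k. if k \<ge> 1 then a k n else 0)"

end

theory Submission
  imports Defs
begin

text \<open>
  Multiplying row \<open>k + 1\<close> by \<open>1 - t\<close> turns the recurrence into
  \<open>(1 - t) * R (k + 1) = R k + a (k + 1) 0 * t\<close>, the last term
  accounting for the missing constant coefficient. Iterating gives the row formula; the recurrence is
  symmetric in rows and columns, so the column formula is the row formula of the transposed array.
\<close>

unbundle fps_syntax

lemma row_series_Suc:
  fixes a :: "nat \<Rightarrow> nat \<Rightarrow> real"
  assumes "\<And>k n. n \<ge> 1 \<Longrightarrow> k \<ge> 1 \<Longrightarrow> a k n = a k (n - 1) + a (k - 1) n"
  shows "(1 - fps_X) * row_series a (Suc k) = row_series a k + fps_X * fps_const (a (Suc k) 0)"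
proof (rule fps_ext)
  fix n
  \<comment> \<open>For \<open>n \<ge> 2\<close> this is the recurrence itself. At
    \<open>n = 1\<close> the left side has 0 where the recurrence has \<open>a (Suc k) 0\<close>,
    which the \<open>fps_X\<close> term supplies; at \<open>n = 0\<close> both sides vanish.\<close>
  show "((1 - fps_X) * row_series a (Suc k)) $ n
      = (row_series a k + fps_X * fps_const (a (Suc k) 0)) $ n"
    using assms[of n "Suc k"]
    by (cases "n = 0"; cases "n = 1") (auto simp: row_series_def left_diff_distrib)
qed

lemma row_series_closed_form:
  fixes a :: "nat \<Rightarrow> nat \<Rightarrow> real"
  assumes rec: "\<And>k n. n \<ge> 1 \<Longrightarrow> k \<ge> 1 \<Longrightarrow> a k n = a k (n - 1) + a (k - 1) n"
  shows "row_series a k =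
           1 / (1 - fps_X) ^ k *
             (row_series a 0 + fps_X / (1 - fps_X) * (\<Sum>r=1..k. fps_const (a r 0) * (1 - fps_X) ^ r))"
proof -
  define U :: "real fps" where "U = 1 - fps_X"
  have unit: "U $ 0 \<noteq> 0"
    by (simp add: U_def)
  have UI: "U * inverse U = 1"
    by (rule inverse_mult_eq_1'[OF unit])
  have step: "U * row_series a (Suc k) = row_series a k + fps_X * fps_const (a (Suc k) 0)" for k
    unfolding U_def by (rule row_series_Suc[of a, OF rec])
  \<comment> \<open>With the denominator cleared, passing from \<open>k\<close> to
    \<open>Suc k\<close> only adds the summand \<open>r = Suc k\<close>.\<close>
  have *: "U ^ k * row_series a k =
             row_series a 0 + fps_X / U * (\<Sum>r=1..k. fps_const (a r 0) * U ^ r)" for k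
  proof (induction k)
    case 0
    show ?case by simp
  next
    case (Suc k)
    have "U ^ Suc k * row_series a (Suc k) = U ^ k * (U * row_series a (Suc k))"
      by (simp add: mult_ac)
    \<comment> \<open>The factor \<open>U * inverse U = 1\<close> is inserted so that
      \<open>U ^ k\<close> can be rewritten as \<open>U ^ Suc k\<close> divided by \<open>U\<close>,
      the shape of the new summand.\<close>
    also have "\<dots> = U ^ k * row_series a k + fps_X * fps_const (a (Suc k) 0) * U ^ k * (U * inverse U)"
      unfolding step UI by (simp add: algebra_simps)
    also have "\<dots> = U ^ k * row_series a k + fps_X / U * (fps_const (a (Suc k) 0) * U ^ Suc k)"
      by (simp add: fps_divide_unit[OF unit] mult_ac)
    finally show ?case
      unfolding Suc.IH by (simp add: distrib_left)
  qed
  \<comment> \<open>\<open>U ^ k\<close> has constant coefficient 1, hence is a unit and can be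
    cancelled.\<close>
  have "1 / U ^ k * U ^ k = 1"
    using unit by (simp add: fps_divide_unit inverse_mult_eq_1)
  then have "row_series a k = 1 / U ^ k * (U ^ k * row_series a k)"
    by (metis mult.assoc mult_1)
  then show ?thesis
    unfolding * by (simp only: U_def)
qed

lemma column_series_eq_row_series_transpose:
  "column_series a n = row_series (\<lambda>i j. a j i) n"
  by (simp add: column_series_def row_series_def)

theorem theorem3:
  fixes a :: "nat \<Rightarrow> nat \<Rightarrow> real"
  assumes "\<And>k n. n \<ge> 1 \<Longrightarrow> k \<ge> 1 \<Longrightarrow> a k n = a k (n - 1) + a (k - 1) n"
  shows "(\<forall>k\<ge>1. row_series a k =
            1 / (1 - fps_X) ^ k *
              (row_series a 0 + fps_X / (1 - fps_X) * (\<Sum>r=1..k. fps_const (a r 0) * (1 - fps_X) ^ r))) \<and>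
         (\<forall>n\<ge>1. column_series a n =
            1 / (1 - fps_X) ^ n *
              (column_series a 0 + fps_X / (1 - fps_X) * (\<Sum>j=1..n. fps_const (a 0 j) * (1 - fps_X) ^ j)))"
proof -
  \<comment> \<open>Transposing the array merely exchanges the two summands of the
    recurrence.\<close>
  have transposed: "a n k = a (n - 1) k + a n (k - 1)" if "n \<ge> 1" "k \<ge> 1" for k n
    using assms[OF that(2,1)] by simp
  show ?thesis
    unfolding column_series_eq_row_series_transpose
    using row_series_closed_form[of a, OF assms]
      row_series_closed_form[of "\<lambda>i j. a j i", OF transposed]
    by blast
qed

end
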